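(* \[\sum_{k=0}^{\infty}\left(\frac{-1}{4}\right)^k\frac{(1)_k^5}{(\frac{3}{2})_k^5}(10k^2+14k+5)\Big[16H_{2k+1}^{(4)}+3H_{k}^{(4)}\Big]=\frac{127\,\zeta(7)}{2}.\]
   Context: For a number $x$ and a nonnegative integer $m$, the shifted factorial is $(x)_0=1$ and $(x)_m=x(x+1)\cdots(x+m-1)$ for $m\ge 1$; $(x)_k^5$ means $((x)_k)^5$. For $\ell\in\mathbb{Z}^{+}$ and an integer $n\ge 0$, the harmonic number of order $\ell$ is $H_n^{(\ell)}=\sum_{k=1}^n \frac{1}{k^{\ell}}$ (so $H_0^{(\ell)}=0$). $\zeta(s)=\sum_{k=1}^\infty k^{-s}$ is the Riemann zeta function for $\Re(s)>1$. *)

theory Defs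
  imports "HOL-Analysis.Analysis"
begin

definition harmonic :: "nat \<Rightarrow> nat \<Rightarrow> real" where
  "harmonic l n = (\<Sum>k = 1..n. 1 / real k ^ l)"

text \<open>
  The Dirichlet series of the Riemann zeta function; it represents the zeta function only
  where the series converges, i.e. for \<open>Re s > 1\<close> (no analytic continuation is intended).
\<close>
definition zeta :: "complex \<Rightarrow> complex" where
  "zeta s = (\<Sum>k. of_nat (Suc k) powr (- s))"

end

theory Submission
  imports Defs "HOL-Real_Asymp.Real_Asymp"
begin

text \<open>
  The idea is to work with a generating function in a parameter \<open>y\<close> and to keep only its first-order
  coefficient. For \<open>x > 0\<close> and small \<open>y\<close> put
  \<open>K\<^sub>y(m, x) = (-1)\<^sup>m (m!)\<^sup>2 / (2m)! \<cdot> (\<Prod>j=1..m. j\<^sup>4 + 4y) / (\<Prod>j=0..m. (x + j)\<^sup>4 - y)\<close>.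
  Along \<open>x, x + 1, x + 2, \<dots>\<close> this is, up to a linear factor, the summand of a well-poised series whose parameters
  involve the fourth roots \<open>\<omega>\<close> of \<open>y\<close>; the normalising numerator \<open>j\<^sup>4 + 4y\<close> is the product of the factors
  \<open>j + \<omega> + \<omega>'\<close> for adjacent roots. There is a Wilf--Zeilberger pair
  \<open>F\<^sub>y(m, x) = (2x + m) K\<^sub>y(m, x)\<close> and \<open>G\<^sub>y(m, x) = c(m, x) K\<^sub>y(m, x)\<close> with a rational certificate \<open>c\<close>
  that does not involve \<open>y\<close>, such that
  \<open>G\<^sub>y(m, x + 1) - G\<^sub>y(m, x) = F\<^sub>y(m, x) - F\<^sub>y(m + 1, x)\<close>.

  Summing this over the quarter plane of all \<open>m\<close> and all points \<open>x, x + 1, x + 2, \<dots>\<close> leaves only the two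
  boundary sums, so that
  \<open>- (\<Sum>m. G\<^sub>y(m, x)) = (\<Sum>n. F\<^sub>y(0, x + n)) = (\<Sum>n. 2(x + n) / ((x + n)\<^sup>4 - y))\<close>.
  The coefficient of \<open>y\<close> on the right is \<open>\<Sum>n. 2 / (x + n)\<^sup>7\<close>. On the left every summand is multiplied by
  the logarithmic derivative of \<open>K\<^sub>y\<close> in \<open>y\<close> at \<open>0\<close>, which is
  \<open>4 (\<Sum>j=1..m. 1 / j\<^sup>4) + (\<Sum>j=0..m. 1 / (x + j)\<^sup>4)\<close>; this is where the harmonic numbers come from.
  At \<open>x = 1/2\<close> the left side becomes four times the series in question and the right side is
  \<open>2 (2\<^sup>7 - 1) \<zeta>(7)\<close>.

  The proof differentiates by hand: it uses the pair of \<open>y\<close>-derivatives at \<open>0\<close> directly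
  (\<open>wz_pair\<close>), shows that the outer boundary of the quarter plane contributes nothing because the
  kernel decays like \<open>2\<^sup>-\<^sup>m x\<^sup>-\<^sup>4\<close> (\<open>abs_kern_le\<close>), and so obtains the acceleration formula
  \<open>hurwitz7_acceleration\<close> for all \<open>x > 0\<close>, of which the result is the case \<open>x = 1/2\<close>.
\<close>

section \<open>A Wilf--Zeilberger pair\<close>

text \<open>The kernel \<open>K\<^sub>y(m, x)\<close> at \<open>y = 0\<close>.\<close>
definition kern :: "nat \<Rightarrow> real \<Rightarrow> real" where
  "kern m x = (-1) ^ m * fact m ^ 6 / (fact (2 * m) * pochhammer x (Suc m) ^ 4)"

text \<open>The logarithmic derivative of \<open>K\<^sub>y(m, x)\<close> with respect to \<open>y\<close> at \<open>y = 0\<close>.\<close>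
definition logder :: "nat \<Rightarrow> real \<Rightarrow> real" where
  "logder m x = 4 * harmonic 4 m + (\<Sum>j<Suc m. 1 / (x + real j) ^ 4)"

text \<open>The \<open>y\<close>-derivative of \<open>F\<^sub>y(m, x)\<close> at \<open>y = 0\<close>.\<close>
definition wzF :: "nat \<Rightarrow> real \<Rightarrow> real" where
  "wzF m x = (2 * x + real m) * kern m x * logder m x"

text \<open>
  The certificate. It is the quadratic polynomial in \<open>x\<close> that solves the difference equation in
  \<open>cert_order1\<close>, with its constant term fixed by \<open>cert_order0\<close> at \<open>x = 0\<close>.
\<close>
definition cert :: "nat \<Rightarrow> real \<Rightarrow> real" where
  "cert m x = - (x ^ 2 + (3 * real m + 1) * x + (5 * real m ^ 2 + 4 * real m + 1) / 2)
                / (2 * real m + 1)"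

text \<open>The \<open>y\<close>-derivative of \<open>G\<^sub>y(m, x)\<close> at \<open>y = 0\<close>.\<close>
definition wzG :: "nat \<Rightarrow> real \<Rightarrow> real" where
  "wzG m x = cert m x * kern m x * logder m x"

lemma kern_shift:
  assumes "x > 0"
  shows "kern m (x + 1) = kern m x * (x ^ 4 / (x + real m + 1) ^ 4)"
proof -
  have p: "pochhammer x (Suc m) > 0"
    using assms by (rule pochhammer_pos)
  have "x * pochhammer (x + 1) (Suc m) = pochhammer x (Suc m) * (x + real m + 1)"
    using pochhammer_rec[of x "Suc m"] pochhammer_Suc[of x "Suc m"] by (simp add: add_ac)
  then have "pochhammer (x + 1) (Suc m) = pochhammer x (Suc m) * (x + real m + 1) / x"
    using assms by (simp add: field_simps)
  then show ?thesis
    unfolding kern_def using assms p by (simp add: power_mult_distrib power_divide)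
qed

lemma kern_Suc:
  assumes "x > 0"
  shows "kern (Suc m) x
    = - kern m x * ((real m + 1) ^ 5 / (2 * (2 * real m + 1) * (x + real m + 1) ^ 4))"
proof -
  have p: "pochhammer x (Suc m) > 0"
    using assms by (rule pochhammer_pos)
  have f: "fact (2 * Suc m) = (2 * (real m + 1)) * (2 * real m + 1) * fact (2 * m)"
    by (simp add: algebra_simps)
  have P: "pochhammer x (Suc (Suc m)) = pochhammer x (Suc m) * (x + real m + 1)"
    by (subst pochhammer_Suc) (simp add: add_ac)
  have fm: "fact (Suc m) = (real m + 1) * fact m"
    by (simp add: algebra_simps)
  have c: "a ^ 6 / ((2 * a) * q) = a ^ 5 / (2 * q)" if "a > 0" for a q :: real
    using that by (simp add: power_numeral_reduce)
  have "kern (Suc m) x = - kern m x * ((real m + 1) ^ 6 / (2 * (real m + 1) * (2 * real m + 1)))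
           / (x + real m + 1) ^ 4"
    unfolding kern_def f P fm by (simp only: power_mult_distrib) (simp add: mult_ac)
  then show ?thesis
    by (subst (asm) c) simp_all
qed

lemma logder_shift:
  "logder m (x + 1) = logder m x - 1 / x ^ 4 + 1 / (x + real m + 1) ^ 4"
proof -
  have "(\<Sum>j<Suc (Suc m). 1 / (x + real j) ^ 4)
        = 1 / x ^ 4 + (\<Sum>j<Suc m. 1 / (x + 1 + real j) ^ 4)"
    by (subst sum.lessThan_Suc_shift) (simp add: add_ac)
  then show ?thesis
    unfolding logder_def by (simp add: add_ac)
qed

lemma logder_Suc:
  "logder (Suc m) x = logder m x + 4 / (real m + 1) ^ 4 + 1 / (x + real m + 1) ^ 4"
  unfolding logder_def harmonic_def by (simp add: add_ac)

text \<open>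
  Dividing the relation between \<open>F\<^sub>y\<close> and \<open>G\<^sub>y\<close> by \<open>K\<^sub>y(m, x)\<close> and clearing the factor
  \<open>(x + m + 1)\<^sup>4 - y\<close> turns it into an identity of polynomials of degree one in \<open>y\<close>. The next two lemmas are its
  coefficients of \<open>y\<^sup>0\<close> and of \<open>- y\<close>.
\<close>
lemma cert_order0:
  "cert m (x + 1) * x ^ 4 - cert m x * (x + real m + 1) ^ 4
    = (2 * x + real m) * (x + real m + 1) ^ 4
      + (2 * x + real m + 1) * ((real m + 1) ^ 5 / (2 * (2 * real m + 1)))"
proof -
  have q: "2 * real m + 1 \<noteq> 0" by linarith
  show ?thesis
    unfolding cert_def using q by (simp add: divide_simps) algebra
qed

lemma cert_order1:
  "cert m (x + 1) - cert m x
    = (2 * x + real m) - 4 * (2 * x + real m + 1) * ((real m + 1) / (2 * (2 * real m + 1)))"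
proof -
  have q: "2 * real m + 1 \<noteq> 0" by linarith
  show ?thesis
    unfolding cert_def using q by (simp add: divide_simps) algebra
qed

text \<open>
  The derivative of the relation at \<open>y = 0\<close>. After division by the kernel, the part proportional to the
  logarithmic derivative is \<open>cert_order0\<close>; the remaining part reduces to \<open>cert_order1\<close> once
  \<open>cert_order0\<close> has been used to eliminate \<open>cert m (x + 1) * x ^ 4\<close>.
\<close>
lemma wz_pair:
  assumes x: "x > 0"
  shows "wzG m (x + 1) - wzG m x = wzF m x - wzF (Suc m) x"
proof -
  define r where "r = real m + 1"
  define t where "t = x + real m + 1"
  define z where "z = (2 * x + real m + 1) * (r / (2 * (2 * real m + 1)))"
  define w where "w = 2 * x + real m"
  define l where "l = logder m x"
  have nz: "x \<noteq> 0" "t \<noteq> 0" "r \<noteq> 0" using x by (auto simp: t_def r_def)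
  have r5: "r ^ 5 = r * r ^ 4" by (simp add: power_numeral_reduce)
  have e0: "cert m (x + 1) * x ^ 4 - cert m x * t ^ 4 = w * t ^ 4 + z * r ^ 4"
    using cert_order0[of m x] unfolding t_def z_def w_def r_def by (simp add: power_numeral_reduce)
  have e1: "cert m (x + 1) - cert m x = w - 4 * z"
    using cert_order1[of m x] unfolding z_def w_def r_def by simp
  have G: "wzG m (x + 1) = kern m x * (cert m (x + 1) * (x ^ 4 / t ^ 4) * (l - 1 / x ^ 4 + 1 / t ^ 4))"
    unfolding wzG_def kern_shift[OF x] logder_shift t_def l_def by simp
  have F: "wzF (Suc m) x = - kern m x * (z * (r ^ 4 / t ^ 4) * (l + 4 / r ^ 4 + 1 / t ^ 4))"
    unfolding wzF_def kern_Suc[OF x] logder_Suc t_def z_def l_def r_def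
    by (simp add: power_numeral_reduce)
  have "cert m (x + 1) * (x ^ 4 / t ^ 4) * (l - 1 / x ^ 4 + 1 / t ^ 4) - cert m x * l
      = w * l + z * (r ^ 4 / t ^ 4) * (l + 4 / r ^ 4 + 1 / t ^ 4)"
  proof -
    have i: "cert m (x + 1) * (x ^ 4 / t ^ 4) = cert m x + w + z * (r ^ 4 / t ^ 4)"
      using e0 nz by (simp add: field_simps)
    have "cert m (x + 1) * (x ^ 4 / t ^ 4) * (l - 1 / x ^ 4 + 1 / t ^ 4)
        = (cert m (x + 1) * (x ^ 4 / t ^ 4)) * (l + 1 / t ^ 4) - cert m (x + 1) / t ^ 4"
    proof -
      have "(x ^ 4 / t ^ 4) * (1 / x ^ 4) = 1 / t ^ 4" using nz by simp
      then have "cert m (x + 1) * (x ^ 4 / t ^ 4) * (1 / x ^ 4) = cert m (x + 1) / t ^ 4"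
        by (simp only: mult.assoc) simp
      then show ?thesis by (simp only: ring_distribs)
    qed
    also have "\<dots> = (cert m x + w + z * (r ^ 4 / t ^ 4)) * (l + 1 / t ^ 4)
        - (cert m x + w - 4 * z) / t ^ 4"
      unfolding i using e1 by (simp add: algebra_simps)
    also have "\<dots> = cert m x * l + w * l + z * (r ^ 4 / t ^ 4) * (l + 4 / r ^ 4 + 1 / t ^ 4)"
      using nz by (simp add: field_simps)
    finally show ?thesis by simp
  qed
  then have "kern m x * (cert m (x + 1) * (x ^ 4 / t ^ 4) * (l - 1 / x ^ 4 + 1 / t ^ 4) - cert m x * l)
      = kern m x * (w * l + z * (r ^ 4 / t ^ 4) * (l + 4 / r ^ 4 + 1 / t ^ 4))"
    by simp
  then show ?thesis
    unfolding G F by (simp add: wzG_def wzF_def l_def w_def algebra_simps)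
qed

section \<open>Decay at the outer boundary\<close>

lemma fact_square_le: "2 ^ m * fact m ^ 2 \<le> (fact (2 * m) :: real)"
proof (induction m)
  case (Suc m)
  have "(2 ^ Suc m * fact (Suc m) ^ 2 :: real) = 2 * (real m + 1) ^ 2 * (2 ^ m * fact m ^ 2)"
    by (simp add: power2_eq_square algebra_simps)
  also have "\<dots> \<le> 2 * (real m + 1) ^ 2 * fact (2 * m)"
    using Suc by (intro mult_left_mono) auto
  also have "\<dots> \<le> (2 * (real m + 1)) * (2 * real m + 1) * fact (2 * m)"
    by (intro mult_right_mono) (auto simp: power2_eq_square algebra_simps)
  also have "\<dots> = fact (2 * Suc m)"
    by (simp add: algebra_simps)
  finally show ?case .
qed simp

text \<open>
  In \<open>pochhammer x (Suc m)\<close> the factor \<open>x\<close> is split off and the others are compared with \<open>1, \<dots>, m\<close>.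
  This uses up four of the six factorials; the remaining quotient \<open>(m!)\<^sup>2 / (2m)!\<close> gives the geometric decay.
\<close>
lemma abs_kern_le:
  assumes "x > 0"
  shows "\<bar>kern m x\<bar> \<le> (1 / 2) ^ m / x ^ 4"
proof -
  have "fact m \<le> pochhammer (x + 1) m"
    unfolding pochhammer_fact[of m] pochhammer_prod
    using assms by (intro prod_mono) auto
  then have "x * fact m \<le> pochhammer x (Suc m)"
    using assms by (simp add: pochhammer_rec)
  then have le: "(x * fact m) ^ 4 \<le> pochhammer x (Suc m) ^ 4"
    using assms by (intro power_mono) auto
  have "\<bar>kern m x\<bar> = fact m ^ 6 / (fact (2 * m) * pochhammer x (Suc m) ^ 4)"
    using assms by (simp add: kern_def abs_mult power_abs)
  also have "\<dots> \<le> fact m ^ 6 / ((2 ^ m * fact m ^ 2) * (x * fact m) ^ 4)"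
    using assms by (intro divide_left_mono mult_mono fact_square_le le mult_pos_pos)
      (auto simp: less_imp_neq[OF pochhammer_pos, symmetric] intro!: zero_less_power pochhammer_pos)
  also have "\<dots> = (1 / 2) ^ m / x ^ 4"
  proof -
    have "a ^ 6 / ((c * a ^ 2) * (x * a) ^ 4) = (1 / c) / x ^ 4" if "a > 0" "c > 0" for a c :: real
      using that assms by (simp add: power_numeral_reduce)
    then show ?thesis by (simp add: power_divide)
  qed
  finally show ?thesis .
qed

text \<open>
  Linear growth in \<open>m\<close> is harmless against the geometric decay of the kernel, so each summand is just
  estimated by its largest possible value.
\<close>
lemma logder_bounds:
  assumes "0 < x" "x \<le> y"
  shows "0 \<le> logder m y" "logder m y \<le> (real m + 1) * (4 + 1 / x ^ 4)"
proof -
  have "harmonic 4 m \<le> (\<Sum>k = 1..m. 1)"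
    unfolding harmonic_def by (intro sum_mono) auto
  moreover have "(\<Sum>j<Suc m. 1 / (y + real j) ^ 4) \<le> (\<Sum>j<Suc m. 1 / x ^ 4)"
    using assms by (intro sum_mono divide_left_mono power_mono mult_pos_pos) auto
  ultimately show "logder m y \<le> (real m + 1) * (4 + 1 / x ^ 4)"
    unfolding logder_def by (simp add: algebra_simps)
  show "0 \<le> logder m y"
    unfolding logder_def harmonic_def using assms by (intro add_nonneg_nonneg mult_nonneg_nonneg sum_nonneg) auto
qed

lemma abs_wz_le:
  assumes "0 < x" "x \<le> y"
  shows "\<bar>kern m y * logder m y\<bar> \<le> (1 / 2) ^ m * (real m + 1) * (4 + 1 / x ^ 4) / y ^ 4"
proof -
  have "\<bar>kern m y * logder m y\<bar> \<le> ((1 / 2) ^ m / y ^ 4) * ((real m + 1) * (4 + 1 / x ^ 4))"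
    unfolding abs_mult using assms logder_bounds[OF assms, of m] abs_kern_le[of y m]
    by (intro mult_mono) auto
  then show ?thesis by (simp add: field_simps)
qed

lemma abs_wzF_le:
  assumes "0 < x" "x \<le> y"
  shows "\<bar>wzF m y\<bar> \<le> (2 + real m / x) * (1 / 2) ^ m * (real m + 1) * (4 + 1 / x ^ 4) * inverse (y ^ 3)"
proof -
  have y: "y > 0" using assms by simp
  have "real m * x \<le> real m * y" using assms by (intro mult_left_mono) auto
  then have "2 * y + real m \<le> (2 + real m / x) * y"
    using assms by (simp add: field_simps)
  then have "\<bar>wzF m y\<bar> \<le> ((2 + real m / x) * y) * ((1 / 2) ^ m * (real m + 1) * (4 + 1 / x ^ 4) / y ^ 4)"
    unfolding wzF_def mult.assoc[of _ "kern m y"] abs_mult[of "2 * y + real m"]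
    using y by (intro mult_mono abs_wz_le[OF assms]) auto
  also have "\<dots> = (2 + real m / x) * (1 / 2) ^ m * (real m + 1) * (4 + 1 / x ^ 4) * inverse (y ^ 3)"
    using y by (simp add: power_numeral_reduce divide_simps)
  finally show ?thesis .
qed

lemma wzG_tendsto_0:
  assumes x: "x > 0"
  shows "(\<lambda>n. wzG m (x + real n)) \<longlonglongrightarrow> 0"
proof (rule tendsto_rabs_zero_cancel, rule tendsto_sandwich)
  define C where "C = (1 / 2) ^ m * (real m + 1) * (4 + 1 / x ^ 4)"
  show "\<forall>\<^sub>F n in sequentially. 0 \<le> \<bar>wzG m (x + real n)\<bar>" by simp
  show "\<forall>\<^sub>F n in sequentially. \<bar>wzG m (x + real n)\<bar> \<le> \<bar>cert m (x + real n)\<bar> * (C / (x + real n) ^ 4)"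
  proof (intro always_eventually allI)
    fix n
    show "\<bar>wzG m (x + real n)\<bar> \<le> \<bar>cert m (x + real n)\<bar> * (C / (x + real n) ^ 4)"
      unfolding wzG_def C_def mult.assoc[of _ "kern m _"] abs_mult[of "cert m _"]
      using x by (intro mult_left_mono abs_wz_le) auto
  qed
  define a b q where "a = 3 * real m + 1" and "b = (5 * real m ^ 2 + 4 * real m + 1) / 2"
    and "q = 2 * real m + 1"
  have pos: "a > 0" "b > 0" "q > 0" "C > 0"
    unfolding a_def b_def q_def C_def using x by (auto intro!: add_nonneg_pos mult_pos_pos)
  have "(\<lambda>n. \<bar>- ((x + real n) ^ 2 + a * (x + real n) + b) / q\<bar> * (C / (x + real n) ^ 4)) \<longlonglongrightarrow> 0"
  proof -
    have "(\<lambda>n. (- ((x + real n) ^ 2 + a * (x + real n) + b) / q) * (C / (x + real n) ^ 4)) \<longlonglongrightarrow> 0"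
      using pos x by real_asymp
    then have "(\<lambda>n. \<bar>(- ((x + real n) ^ 2 + a * (x + real n) + b) / q) * (C / (x + real n) ^ 4)\<bar>) \<longlonglongrightarrow> 0"
      by (rule tendsto_rabs_zero)
    then show ?thesis using x pos by (simp add: abs_mult)
  qed
  then show "(\<lambda>n. \<bar>cert m (x + real n)\<bar> * (C / (x + real n) ^ 4)) \<longlonglongrightarrow> 0"
    unfolding cert_def a_def b_def q_def .
qed simp

section \<open>Summation over the quarter plane\<close>

text \<open>
  For fixed \<open>m\<close> the pair telescopes along \<open>x, x + 1, \<dots>\<close>, which shows that \<open>- wzG m x\<close> is the difference of the
  row sums \<open>S m\<close> and \<open>S (Suc m)\<close>. As \<open>S\<close> tends to \<open>0\<close>, a second telescoping in \<open>m\<close> leaves \<open>S 0\<close>.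
\<close>
theorem hurwitz7_acceleration:
  assumes x: "x > 0"
  shows "(\<lambda>m. - wzG m x) sums (\<Sum>n. 2 / (x + real n) ^ 7)"
proof -
  define c where "c m = (2 + real m / x) * (1 / 2) ^ m * (real m + 1) * (4 + 1 / x ^ 4)" for m
  define K where "K = (\<Sum>n. inverse ((x + real n) ^ 3))"
  define S where "S m = (\<Sum>n. wzF m (x + real n))" for m
  have sumK: "summable (\<lambda>n. inverse ((x + real n) ^ 3))"
    using x by (intro Polygamma_converges') auto
  have bound: "\<bar>wzF m (x + real n)\<bar> \<le> c m * inverse ((x + real n) ^ 3)" for m n
    unfolding c_def by (rule abs_wzF_le[OF x]) simp
  have sumF: "summable (\<lambda>n. \<bar>wzF m (x + real n)\<bar>)" for m
    by (rule summable_comparison_test_ev[OF always_eventually summable_mult[OF sumK, of "c m"]])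
      (use bound in auto)
  have "\<bar>S m\<bar> \<le> c m * K" for m
  proof -
    have "\<bar>S m\<bar> \<le> (\<Sum>n. \<bar>wzF m (x + real n)\<bar>)"
      unfolding S_def by (rule summable_rabs[OF sumF])
    also have "\<dots> \<le> (\<Sum>n. c m * inverse ((x + real n) ^ 3))"
      by (intro suminf_le bound sumF summable_mult sumK)
    also have "\<dots> = c m * K"
      unfolding K_def by (rule suminf_mult[OF sumK])
    finally show ?thesis .
  qed
  moreover have "(\<lambda>m. c m * K) \<longlonglongrightarrow> 0"
  proof -
    have "(\<lambda>m. (1 / 2) ^ m * (real m + 1)) \<longlonglongrightarrow> 0"
      and "(\<lambda>m. real m * (1 / 2) ^ m * (real m + 1)) \<longlonglongrightarrow> 0"
      by real_asymp+
    then have "(\<lambda>m. (2 * ((1 / 2) ^ m * (real m + 1)) + real m * (1 / 2) ^ m * (real m + 1) / x)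
        * ((4 + 1 / x ^ 4) * K)) \<longlonglongrightarrow> 0"
    by (intro tendsto_mult_left_zero tendsto_add_zero tendsto_divide_zero tendsto_mult_right_zero)
    then show ?thesis
      unfolding c_def by (simp add: algebra_simps)
  qed
  ultimately have "S \<longlonglongrightarrow> 0"
    by (intro Lim_null_comparison[of S]) auto
  then have "(\<lambda>m. S m - S (Suc m)) sums (S 0 - 0)"
    by (rule telescope_sums')
  moreover have "S m - S (Suc m) = - wzG m x" for m
  proof -
    have "(\<lambda>n. wzG m (x + real (Suc n)) - wzG m (x + real n)) sums (0 - wzG m (x + real 0))"
      by (rule telescope_sums[OF wzG_tendsto_0[OF x]])
    moreover have "wzG m (x + real (Suc n)) - wzG m (x + real n)
        = wzF m (x + real n) - wzF (Suc m) (x + real n)" for n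
      using wz_pair[of "x + real n" m] x by (simp add: add_ac)
    ultimately have "(\<lambda>n. wzF m (x + real n) - wzF (Suc m) (x + real n)) sums (- wzG m x)"
      by simp
    moreover have "(\<lambda>n. wzF m (x + real n) - wzF (Suc m) (x + real n)) sums (S m - S (Suc m))"
      unfolding S_def
      by (intro sums_diff summable_sums summable_rabs_cancel[OF sumF])
    ultimately show ?thesis
      using sums_unique2 by blast
  qed
  moreover have "wzF 0 (x + real n) = 2 / (x + real n) ^ 7" for n
  proof -
    have "wzF 0 y = 2 / y ^ 7" if "y > 0" for y
      using that by (simp add: wzF_def kern_def logder_def harmonic_def power_numeral_reduce)
    then show ?thesis using x by simp
  qed
  ultimately show ?thesis
    unfolding S_def by simp
qed

section \<open>The case of one half\<close>

text \<open>
  The sum \<open>\<Sum>j=0..m. 1 / (j + 1/2)\<^sup>4\<close> is sixteen times the part of \<open>harmonic 4 (2 * m + 1)\<close> with odd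
  denominators; adding the even part costs one \<open>harmonic 4 m\<close>, which leaves three of the four.
\<close>
lemma logder_half: "logder m (1 / 2) = 16 * harmonic 4 (2 * m + 1) + 3 * harmonic 4 m"
proof (induction m)
  case 0
  show ?case by (simp add: logder_def harmonic_def power_divide)
next
  case (Suc m)
  have "1 / (1 / 2 + real m + 1) ^ 4 = 16 / real (2 * m + 3) ^ 4"
    by (simp add: field_simps)
  moreover have "16 / real (2 * m + 2) ^ 4 = 1 / (real m + 1) ^ 4"
  proof -
    have "real (2 * m + 2) ^ 4 = (2 * (real m + 1)) ^ 4" by (simp add: algebra_simps)
    then show ?thesis unfolding power_mult_distrib by simp
  qed
  moreover have "harmonic 4 (2 * Suc m + 1)
      = harmonic 4 (2 * m + 1) + 1 / real (2 * m + 2) ^ 4 + 1 / real (2 * m + 3) ^ 4"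
    by (simp add: harmonic_def eval_nat_numeral)
  moreover have "harmonic 4 (Suc m) = harmonic 4 m + 1 / (real m + 1) ^ 4"
    by (simp add: harmonic_def add_ac)
  ultimately show ?case
    unfolding logder_Suc Suc.IH by simp
qed

text \<open>
  One of the five quotients comes from \<open>(m!)\<^sup>2 / (2m)!\<close> by the duplication formula \<open>d\<close>, together with
  \<open>4\<^sup>-\<^sup>m\<close>; the other four come from \<open>pochhammer (1/2) (m + 1)\<close>.
\<close>
lemma kern_half:
  "kern m (1 / 2)
    = 16 * (2 * real m + 1) * ((- 1 / 4) ^ m * (pochhammer 1 m ^ 5 / pochhammer (3 / 2) m ^ 5))"
proof -
  have d: "fact (2 * m) * (2 * real m + 1) = 4 ^ m * pochhammer (3 / 2) m * fact m"
  proof (induction m)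
    case (Suc m)
    have "fact (2 * Suc m) * (2 * real (Suc m) + 1)
        = (fact (2 * m) * (2 * real m + 1)) * (4 * (3 / 2 + real m) * (real m + 1))"
      by (simp add: algebra_simps)
    also have "\<dots> = 4 ^ Suc m * pochhammer (3 / 2) (Suc m) * fact (Suc m)"
      unfolding Suc by (simp add: pochhammer_Suc algebra_simps)
    finally show ?case .
  qed simp
  have pos: "pochhammer (3 / 2 :: real) m > 0" by (rule pochhammer_pos) simp
  have h: "pochhammer (1 / 2 :: real) (Suc m) = pochhammer (3 / 2) m / 2"
    by (simp add: pochhammer_rec)
  have f: "fact (2 * m) = 4 ^ m * pochhammer (3 / 2) m * fact m / (2 * real m + 1)"
    unfolding d[symmetric] by simp
  have sign: "(- 1 / 4 :: real) ^ m = (-1) ^ m / 4 ^ m" by (rule power_divide)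
  have "s * a ^ 6 / ((c * p * a / q) * (p / 2) ^ 4) = 16 * q * ((s / c) * (a ^ 5 / p ^ 5))"
    if "a > 0" "c > 0" "p > 0" "q > 0" for s a c p q :: real
    using that by (simp add: power_numeral_reduce divide_simps)
  from this[of "fact m" "4 ^ m" "pochhammer (3 / 2) m" "2 * real m + 1" "(-1) ^ m"] show ?thesis
    unfolding kern_def h f sign pochhammer_fact[symmetric] using pos by simp
qed

lemma wzG_half:
  "- wzG m (1 / 2) = 4 * ((- 1 / 4) ^ m * (pochhammer 1 m ^ 5 / pochhammer (3 / 2) m ^ 5)
        * (10 * real m ^ 2 + 14 * real m + 5)
        * (16 * harmonic 4 (2 * m + 1) + 3 * harmonic 4 m))"
proof -
  have "cert m (1 / 2) * (16 * (2 * real m + 1)) = - 4 * (10 * real m ^ 2 + 14 * real m + 5)"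
  proof -
    have q: "2 * real m + 1 \<noteq> 0" by linarith
    show ?thesis
      unfolding cert_def using q by (simp add: field_simps power2_eq_square)
  qed
  then have "- (cert m (1 / 2) * (16 * (2 * real m + 1)) * p * l)
      = 4 * (p * (10 * real m ^ 2 + 14 * real m + 5) * l)" for p l
    by (simp only: mult_ac)
  from this[of "(- 1 / 4) ^ m * (pochhammer 1 m ^ 5 / pochhammer (3 / 2) m ^ 5)"
      "16 * harmonic 4 (2 * m + 1) + 3 * harmonic 4 m"]
  show ?thesis
    unfolding wzG_def kern_half logder_half by (simp only: mult_ac)
qed

lemma zeta_7: "(\<lambda>n. 1 / real (Suc n) ^ 7) sums Re (zeta 7)" "Im (zeta 7) = 0"
proof -
  have e: "of_nat (Suc k) powr (- 7) = complex_of_real (1 / real (Suc k) ^ 7)" for k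
  proof -
    have "complex_of_nat (Suc k) powr (- 7) = inverse (of_nat (Suc k) powr of_nat 7)"
      by (simp add: powr_minus)
    also have "of_nat (Suc k) powr of_nat 7 = (of_nat (Suc k) :: complex) ^ 7"
      by (subst powr_nat) (simp del: of_nat_Suc)
    finally show ?thesis by (simp add: divide_inverse del: of_nat_Suc)
  qed
  have s: "summable (\<lambda>n. 1 / real (Suc n) ^ 7)"
    using inverse_power_summable[of 7, where ?'a = real] by (subst summable_Suc_iff) (simp add: divide_inverse)
  have "zeta 7 = of_real (\<Sum>n. 1 / real (Suc n) ^ 7)"
    unfolding zeta_def e by (rule suminf_of_real[OF s, symmetric])
  with s show "(\<lambda>n. 1 / real (Suc n) ^ 7) sums Re (zeta 7)" "Im (zeta 7) = 0"
    by (simp_all add: summable_sums)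
qed

text \<open>
  The terms \<open>1 / (n + 1/2)\<^sup>7\<close> are \<open>2\<^sup>7\<close> times the odd terms of the zeta series, and \<open>2\<^sup>7\<close> times the even terms
  give back the whole zeta series.
\<close>
lemma odd_zeta_7: "(\<lambda>n. 1 / (1 / 2 + real n) ^ 7) sums (127 * Re (zeta 7))"
proof -
  define f where "f n = 1 / real (Suc n) ^ 7" for n
  have f: "f sums Re (zeta 7)" unfolding f_def by (rule zeta_7)
  have "(\<lambda>n. sum f {n * 2..<n * 2 + 2}) sums Re (zeta 7)"
    by (rule sums_group[OF f]) simp
  moreover have "sum f {n * 2..<n * 2 + 2} = f (2 * n) + f (2 * n + 1)" for n
    by (simp add: eval_nat_numeral mult_ac)
  ultimately have "(\<lambda>n. 128 * (f (2 * n) + f (2 * n + 1)) - f n)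
      sums (128 * Re (zeta 7) - Re (zeta 7))"
    by (intro sums_diff sums_mult f) simp
  moreover have "128 * (f (2 * n) + f (2 * n + 1)) - f n = 1 / (1 / 2 + real n) ^ 7" for n
  proof -
    have "f (2 * n + 1) = 1 / (2 * real (Suc n)) ^ 7"
      by (simp add: f_def algebra_simps)
    then have "128 * f (2 * n + 1) = f n"
      unfolding f_def power_mult_distrib by simp
    moreover have "real (Suc (2 * n)) = 2 * (1 / 2 + real n)" by simp
    then have "128 * f (2 * n) = 1 / (1 / 2 + real n) ^ 7"
      unfolding f_def power_mult_distrib by (simp only: power_mult_distrib) simp
    ultimately show ?thesis by simp
  qed
  ultimately show ?thesis by simp
qed

theorem theorem1p1:
  "(\<lambda>k. complex_of_real
      ((- 1 / 4) ^ k * (pochhammer 1 k ^ 5 / pochhammer (3 / 2) k ^ 5)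
        * (10 * real k ^ 2 + 14 * real k + 5)
        * (16 * harmonic 4 (2 * k + 1) + 3 * harmonic 4 k)))
    sums (127 * zeta 7 / 2)"
proof -
  have "(\<lambda>n. 2 / (1 / 2 + real n) ^ 7) sums (2 * (127 * Re (zeta 7)))"
    using sums_mult[OF odd_zeta_7, of 2] by simp
  then have "(\<lambda>k. - wzG k (1 / 2)) sums (2 * (127 * Re (zeta 7)))"
    using hurwitz7_acceleration[of "1 / 2"] sums_unique by force
  then have "(\<lambda>k. (- 1 / 4) ^ k * (pochhammer 1 k ^ 5 / pochhammer (3 / 2) k ^ 5)
        * (10 * real k ^ 2 + 14 * real k + 5)
        * (16 * harmonic 4 (2 * k + 1) + 3 * harmonic 4 k)) sums (127 * Re (zeta 7) / 2)"
    unfolding wzG_half by (drule_tac sums_divide[where c = 4]) simp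
  moreover have "complex_of_real (127 * Re (zeta 7) / 2) = 127 * zeta 7 / 2"
    using zeta_7(2) by (simp add: complex_eq_iff)
  ultimately show ?thesis
    using sums_of_real[where ?'a = complex] by fastforce
qed

end
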